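(* Let $\Omega\subset\mathbb{R}^N$ be a bounded domain with $\mathcal{C}^2$-boundary, let $p>0$ and $q<p$. Let $g\in\mathcal{C}^1(\mathbb{R},\mathbb{R}^N)$, let $\sigma\in\mathcal{C}^1_b(\partial\Omega\times(0,\infty))$ with $\sigma\ge0$, and let $u_0\in\mathcal{C}(\overline\Omega)$ with $u_0\ge0$, $u_0\not\equiv0$. If $$\limsup_{\omega\to\infty}\frac{|g(\omega)|}{e^{q\omega}}<\infty,$$ then every positive (maximal classical) solution of $$\begin{cases}\partial_t u=\Delta u-g(u)\cdot\nabla u+e^{pu} & \text{in }\overline\Omega\text{ for }t>0,\\ \sigma\,\partial_t u+\partial_\nu u=0 & \text{on }\partial\Omega\text{ for }t>0,\\ u(\cdot,0)=u_0 & \text{in }\overline\Omega,\end{cases}$$ blows up in finite time.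
   Context: $\nu$ is the outer unit normal field on $\partial\Omega$ and $\partial_\nu$ the outer normal derivative. $\mathcal{C}^1_b$ denotes $\mathcal{C}^1$ functions that are bounded with bounded first derivatives. The unique maximal classical solution is $u\in\mathcal{C}(\overline\Omega\times[0,T))\cap\mathcal{C}^{2,1}(\overline\Omega\times(0,T))$, where $T\in(0,\infty]$ is the maximal existence time, which coincides with the blow-up time in the $L^\infty$-norm: $T=\inf\{s>0 : \lim_{t\nearrow s}\sup_{x\in\overline\Omega}|u(x,t)|=\infty\}$. Blow-up in finite time means $T<\infty$. *)

theory Defs
  imports "HOL-Analysis.Analysis"
begin

text \<open>
  Euclidean space \<open>\<real>\<^sup>N\<close> is an arbitrary type of class \<open>euclidean_space\<close>.  Gradients are represented by
  vectors and Hessians by the derivative of the gradient.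
\<close>

text \<open>\<open>\<phi>\<close> is a local defining function of \<open>\<Omega>\<close> on the open set \<open>U\<close>: it is of class \<open>C\<^sup>2\<close> there, with
  gradient \<open>G\<close>, which vanishes nowhere on \<open>U\<close>, and it is negative exactly in \<open>\<Omega>\<close>.\<close>

definition C2_defining_function ::
  "'a::euclidean_space set \<Rightarrow> 'a set \<Rightarrow> ('a \<Rightarrow> real) \<Rightarrow> ('a \<Rightarrow> 'a) \<Rightarrow> bool" where
  "C2_defining_function \<Omega> U \<phi> G \<longleftrightarrow>
     open U \<and>
     (\<exists>H :: 'a \<Rightarrow> 'a \<Rightarrow>\<^sub>L 'a.
        continuous_on U H \<and>
        (\<forall>y\<in>U. (\<phi> has_derivative (\<lambda>h. G y \<bullet> h)) (at y) \<and>
               (G has_derivative blinfun_apply (H y)) (at y))) \<and>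
     (\<forall>y\<in>U. G y \<noteq> 0 \<and> (y \<in> \<Omega> \<longleftrightarrow> \<phi> y < 0) \<and> (y \<in> frontier \<Omega> \<longleftrightarrow> \<phi> y = 0))"

definition C2_boundary :: "'a::euclidean_space set \<Rightarrow> bool" where
  "C2_boundary \<Omega> \<longleftrightarrow>
     (\<forall>x\<in>frontier \<Omega>. \<exists>U \<phi> G. x \<in> U \<and> C2_defining_function \<Omega> U \<phi> G)"

text \<open>On the boundary, a defining function increases out of \<open>\<Omega>\<close>, so its normalized gradient is the
  outer unit normal, independently of the defining function.\<close>

definition outer_unit_normal :: "'a::euclidean_space set \<Rightarrow> ('a \<Rightarrow> 'a) \<Rightarrow> bool" where
  "outer_unit_normal \<Omega> \<nu> \<longleftrightarrow>
     (\<forall>x\<in>frontier \<Omega>. \<exists>U \<phi> G. x \<in> U \<and> C2_defining_function \<Omega> U \<phi> G \<and> \<nu> x = G x /\<^sub>R norm (G x))"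

text \<open>This is applied to the hypersurface \<open>S = \<partial>\<Omega> \<times> (0,\<infinity>)\<close>, where a derivative within \<open>S\<close> is
  determined in tangential directions only.  The tangential gradient is one admissible choice of \<open>G\<close>
  and the tangential part of any admissible \<open>G\<close>, so the existence of a continuous bounded \<open>G\<close> means
  that the derivatives of \<open>f\<close> along \<open>S\<close> exist and are continuous and bounded.\<close>

definition C1_bounded_on :: "'b::euclidean_space set \<Rightarrow> ('b \<Rightarrow> real) \<Rightarrow> bool" where
  "C1_bounded_on S f \<longleftrightarrow>
     bounded (f ` S) \<and>
     (\<exists>G. continuous_on S G \<and> bounded (G ` S) \<and>
          (\<forall>z\<in>S. (f has_derivative (\<lambda>h. G z \<bullet> h)) (at z within S)))"

text \<open>\<open>u \<in> C\<^sup>2\<^sup>,\<^sup>1\<close> on \<open>X \<times> I\<close> with time derivative \<open>ut\<close>, spatial gradient \<open>Du\<close> and spatial Hessian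
  \<open>D2u\<close>.  It is used with \<open>X = closure \<Omega>\<close>, where the spatial derivatives at boundary points are taken
  within \<open>X\<close>; for \<open>\<Omega>\<close> with \<open>C\<^sup>2\<close>-boundary these are unique and are the continuous extensions of the
  derivatives in \<open>\<Omega>\<close>.\<close>

definition C21_on ::
  "'a::euclidean_space set \<Rightarrow> real set \<Rightarrow> ('a \<Rightarrow> real \<Rightarrow> real) \<Rightarrow>
   ('a \<Rightarrow> real \<Rightarrow> real) \<Rightarrow> ('a \<Rightarrow> real \<Rightarrow> 'a) \<Rightarrow> ('a \<Rightarrow> real \<Rightarrow> 'a \<Rightarrow>\<^sub>L 'a) \<Rightarrow> bool" where
  "C21_on X I u ut Du D2u \<longleftrightarrow>
     continuous_on (X \<times> I) (\<lambda>(x, t). u x t) \<and>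
     continuous_on (X \<times> I) (\<lambda>(x, t). ut x t) \<and>
     continuous_on (X \<times> I) (\<lambda>(x, t). Du x t) \<and>
     continuous_on (X \<times> I) (\<lambda>(x, t). D2u x t) \<and>
     (\<forall>x\<in>X. \<forall>t\<in>I.
        ((\<lambda>s. u x s) has_real_derivative ut x t) (at t within I) \<and>
        ((\<lambda>y. u y t) has_derivative (\<lambda>h. Du x t \<bullet> h)) (at x within X) \<and>
        ((\<lambda>y. Du y t) has_derivative blinfun_apply (D2u x t)) (at x within X))"

definition trace_blinfun :: "('a::euclidean_space \<Rightarrow>\<^sub>L 'a) \<Rightarrow> real" where
  "trace_blinfun A = (\<Sum>b\<in>Basis. blinfun_apply A b \<bullet> b)"

text \<open>Classical solutions on \<open>[0,T)\<close>, \<open>T \<in> (0,\<infinity>]\<close>; the Laplacian is the trace of the Hessian.\<close>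

definition classical_solution ::
  "'a::euclidean_space set \<Rightarrow> ('a \<Rightarrow> 'a) \<Rightarrow> real \<Rightarrow> (real \<Rightarrow> 'a) \<Rightarrow> ('a \<Rightarrow> real \<Rightarrow> real) \<Rightarrow>
   ('a \<Rightarrow> real) \<Rightarrow> ereal \<Rightarrow> ('a \<Rightarrow> real \<Rightarrow> real) \<Rightarrow> bool" where
  "classical_solution \<Omega> \<nu> p g \<sigma> u\<^sub>0 T u \<longleftrightarrow>
     0 < T \<and>
     continuous_on (closure \<Omega> \<times> {t. 0 \<le> t \<and> ereal t < T}) (\<lambda>(x, t). u x t) \<and>
     (\<exists>ut Du D2u.
        C21_on (closure \<Omega>) {t. 0 < t \<and> ereal t < T} u ut Du D2u \<and>
        (\<forall>x\<in>closure \<Omega>. \<forall>t. 0 < t \<and> ereal t < T \<longrightarrow>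
           ut x t = trace_blinfun (D2u x t) - g (u x t) \<bullet> Du x t + exp (p * u x t)) \<and>
        (\<forall>x\<in>frontier \<Omega>. \<forall>t. 0 < t \<and> ereal t < T \<longrightarrow>
           \<sigma> x t * ut x t + Du x t \<bullet> \<nu> x = 0)) \<and>
     (\<forall>x\<in>closure \<Omega>. u x 0 = u\<^sub>0 x)"

text \<open>The blow-up time in the supremum norm of a function on \<open>closure \<Omega> \<times> [0,T)\<close>; it is \<open>\<infinity>\<close> if there
  is no blow-up.  The restriction \<open>s \<le> T\<close> excludes values of \<open>u\<close> outside its domain of definition.\<close>

definition blow_up_time :: "'a::euclidean_space set \<Rightarrow> ereal \<Rightarrow> ('a \<Rightarrow> real \<Rightarrow> real) \<Rightarrow> ereal" where
  "blow_up_time \<Omega> T u =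
     Inf (ereal ` {s. 0 < s \<and> ereal s \<le> T \<and>
       filterlim (\<lambda>t. SUP x\<in>closure \<Omega>. \<bar>u x t\<bar>) at_top (at_left s)})"

text \<open>The maximal existence time \<open>T\<close> coincides with the blow-up time in the supremum norm.  If
  \<open>T = \<infinity>\<close>, the last two conditions hold for every classical solution.\<close>

definition maximal_classical_solution ::
  "'a::euclidean_space set \<Rightarrow> ('a \<Rightarrow> 'a) \<Rightarrow> real \<Rightarrow> (real \<Rightarrow> 'a) \<Rightarrow> ('a \<Rightarrow> real \<Rightarrow> real) \<Rightarrow>
   ('a \<Rightarrow> real) \<Rightarrow> ereal \<Rightarrow> ('a \<Rightarrow> real \<Rightarrow> real) \<Rightarrow> bool" where
  "maximal_classical_solution \<Omega> \<nu> p g \<sigma> u\<^sub>0 T u \<longleftrightarrow>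
     classical_solution \<Omega> \<nu> p g \<sigma> u\<^sub>0 T u \<and>
     \<not> (\<exists>T' v. T < T' \<and> classical_solution \<Omega> \<nu> p g \<sigma> u\<^sub>0 T' v \<and>
          (\<forall>x\<in>closure \<Omega>. \<forall>t. 0 \<le> t \<and> ereal t < T \<longrightarrow> v x t = u x t)) \<and>
     T = blow_up_time \<Omega> T u"

end

theory Submission
  imports Defs
begin

text \<open>
  Let \<open>\<alpha> = p - max q 0\<close> and suppose that the solution is global.  Gluing local defining functions
  with cutoffs gives a \<open>C\<^sup>2\<close> function \<open>\<psi>\<close> with \<open>\<partial>\<^sub>\<nu>\<psi> \<ge> m > 0\<close> on \<open>\<partial>\<Omega>\<close>.  For small \<open>\<epsilon>\<close> and still
  smaller \<open>\<kappa>\<close>, the function \<open>v = - ln (A - \<kappa> t + \<epsilon> \<psi>) / \<alpha>\<close> is a strict subsolution which blows up in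
  finite time: the factor \<open>e\<^sup>-\<^sup>\<alpha>\<^sup>u\<close> reduces the reaction to \<open>e\<^sup>q\<^sup>u\<close> (for \<open>q \<ge> 0\<close>), which dominates the
  convection, while \<open>\<epsilon> \<partial>\<^sub>\<nu>\<psi>\<close> dominates \<open>\<sigma> \<kappa>\<close>.  The comparison \<open>v < u\<close> is the positivity of
  \<open>K = A - \<kappa> t + \<epsilon> \<psi> - e\<^sup>-\<^sup>\<alpha>\<^sup>u\<close>, which must fail at some time; since \<open>v\<close> is strict, the first zero of
  \<open>K\<close> is excluded without Hopf's lemma.
\<close>

section \<open>Derivative tests in one variable, first zeros, and the growth of
  \<open>g\<close>\<close>

lemma deriv_nonneg_at_right_min:
  fixes f :: "real \<Rightarrow> real"
  assumes "(f has_real_derivative d) (at a within {a..a + \<delta>})" "0 < \<delta>"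
    and "\<And>s. a < s \<Longrightarrow> s \<le> a + \<delta> \<Longrightarrow> f a \<le> f s"
  shows "0 \<le> d"
proof (rule ccontr)
  assume "\<not> 0 \<le> d"
  then have "\<exists>e>0. \<forall>h>0. a + h \<in> {a..a + \<delta>} \<longrightarrow> h < e \<longrightarrow> f (a + h) < f a"
    using has_real_derivative_neg_dec_right[OF assms(1)] by simp
  then obtain e where e: "e > 0" "\<And>h. 0 < h \<Longrightarrow> a + h \<in> {a..a + \<delta>} \<Longrightarrow> h < e \<Longrightarrow> f (a + h) < f a"
    by blast
  define h where "h = min (e / 2) \<delta>"
  have "0 < h" "h < e" "h \<le> \<delta>" using e(1) assms(2) by (auto simp: h_def)
  then show False using e(2)[of h] assms(3)[of "a + h"] by auto
qed

lemma deriv_nonpos_at_left_min: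
  fixes f :: "real \<Rightarrow> real"
  assumes "(f has_real_derivative d) (at b)" "a < b"
    and "\<And>s. a \<le> s \<Longrightarrow> s < b \<Longrightarrow> f b \<le> f s"
  shows "d \<le> 0"
proof (rule ccontr)
  assume "\<not> d \<le> 0"
  then obtain e where e: "e > 0" "\<And>h. 0 < h \<Longrightarrow> h < e \<Longrightarrow> f (b - h) < f b"
    using DERIV_pos_inc_left[OF assms(1)] by force
  define h where "h = min (e / 2) (b - a)"
  have "0 < h" "h < e" "h \<le> b - a" using e(1) assms(2) by (auto simp: h_def)
  then show False using e(2)[of h] assms(3)[of "b - h"] by auto
qed

text \<open>Since \<open>f' 0 = 0\<close>, a negative \<open>d\<close> would make \<open>f'\<close>
  negative just to the right of 0, and \<open>f\<close> would strictly decrease there.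
  Differentiability of \<open>f'\<close> at 0 is enough for this argument.\<close>

lemma second_deriv_nonneg_at_local_min:
  fixes f f' :: "real \<Rightarrow> real"
  assumes "0 < \<delta>"
    and f: "\<And>s. \<bar>s\<bar> < \<delta> \<Longrightarrow> (f has_real_derivative f' s) (at s)"
    and f': "(f' has_real_derivative d) (at 0)"
    and min: "\<And>s. \<bar>s\<bar> < \<delta> \<Longrightarrow> f 0 \<le> f s"
  shows "0 \<le> d"
proof (rule ccontr)
  assume "\<not> 0 \<le> d"
  then obtain e where e: "e > 0" "\<And>h. 0 < h \<Longrightarrow> h < e \<Longrightarrow> f' (0 + h) < f' 0"
    using DERIV_neg_dec_right[OF f'] by force
  have 0: "f' 0 = 0"
    using DERIV_local_min[OF f, of 0 \<delta>] min assms(1) by auto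
  define h where "h = min e \<delta> / 2"
  have h: "0 < h" "h < e" "h < \<delta>" using e(1) assms(1) by (auto simp: h_def)
  have "f h < f 0"
  proof (rule DERIV_neg_imp_decreasing_open[OF h(1)])
    fix x assume "0 < x" "x < h"
    then show "\<exists>y. (f has_real_derivative y) (at x) \<and> y < 0"
      using f[of x] e(2)[of x] 0 h by (intro exI[of _ "f' x"]) auto
  next
    show "continuous_on {0..h} f"
      using h by (intro continuous_at_imp_continuous_on ballI DERIV_isCont[OF f]) auto
  qed
  then show False using min[of h] h by auto
qed

text \<open>The points where \<open>K\<close> is nonpositive form a compact set, so one of them has
  least time. At earlier times \<open>K\<close> is positive, and continuity from the left carries
  \<open>K \<ge> 0\<close> over to that time itself.\<close>

lemma first_zero_time:
  fixes K :: "'a::euclidean_space \<Rightarrow> real \<Rightarrow> real"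
  assumes "compact X" and K: "continuous_on (X \<times> {a..b}) (\<lambda>(x, t). K x t)"
    and pos: "\<And>x. x \<in> X \<Longrightarrow> 0 < K x a" and "z \<in> X" "a \<le> b" "K z b < 0"
  obtains x t where "x \<in> X" "a < t" "t \<le> b" "K x t = 0"
    "\<And>y s. y \<in> X \<Longrightarrow> a \<le> s \<Longrightarrow> s \<le> t \<Longrightarrow> 0 \<le> K y s"
proof -
  define Z where "Z = {w \<in> X \<times> {a..b}. (\<lambda>(x, t). K x t) w \<le> 0}"
  have "compact (X \<times> {a..b})" using assms(1) by (intro compact_Times) auto
  moreover from this have "closed Z" unfolding Z_def
    by (intro continuous_on_closed_Collect_le K continuous_on_const compact_imp_closed)
  moreover have "X \<times> {a..b} \<inter> Z = Z" unfolding Z_def by blast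
  ultimately have "compact Z" by (metis compact_Int_closed)
  have "(z, b) \<in> Z" using assms by (auto simp: Z_def)
  then obtain w where w: "w \<in> Z" "\<And>v. v \<in> Z \<Longrightarrow> snd w \<le> snd v"
    using continuous_attains_inf[OF \<open>compact Z\<close>, of snd] continuous_on_snd[OF continuous_on_id] by blast
  obtain x t where xt: "w = (x, t)" by fastforce
  have x: "x \<in> X" "a \<le> t" "t \<le> b" "K x t \<le> 0" using w(1) by (auto simp: Z_def xt)
  have "a < t" using x pos[of x] by (cases "a = t") auto
  have lt: "0 < K y s" if "y \<in> X" "a \<le> s" "s < t" for y s
    using w(2)[of "(y, s)"] that x by (force simp: Z_def xt)
  have ge: "0 \<le> K y s" if "y \<in> X" "a \<le> s" "s \<le> t" for y s
  proof (cases "s = t")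
    case True
    have "continuous_on {a..t} (\<lambda>s. K y s)"
      using x that by (intro continuous_on_compose2[OF K, of "{a..t}" "\<lambda>s. (y, s)", simplified] continuous_intros) auto
    then have "((\<lambda>s. K y s) \<longlongrightarrow> K y t) (at_left t)"
      using \<open>a < t\<close> by (simp add: continuous_on_Icc_at_leftD)
    moreover have "\<forall>\<^sub>F s in at_left t. 0 \<le> K y s"
      unfolding eventually_at_left[OF \<open>a < t\<close>]
      using lt[OF that(1)] \<open>a < t\<close> by (intro exI[of _ a]) (auto intro: less_imp_le)
    ultimately show ?thesis
      using True tendsto_lowerbound trivial_limit_at_left_real by blast
  qed (use lt that in \<open>auto intro: less_imp_le\<close>)
  show thesis
    by (rule that[OF x(1) \<open>a < t\<close> x(3) _ ge]) (use x ge[of x t] in auto)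
qed

text \<open>The limsup controls large \<open>\<omega>\<close>, continuity the compact remainder.
  With \<open>max q 0\<close> the exponential is at least 1 on the half-line, so one constant covers
  both ranges, also for negative \<open>q\<close>.\<close>

lemma exp_growth_bound:
  fixes g :: "real \<Rightarrow> 'a::euclidean_space"
  assumes "continuous_on UNIV g"
    and L: "Limsup at_top (\<lambda>\<omega>. ereal (norm (g \<omega>) / exp (q * \<omega>))) < \<infinity>"
  obtains C where "0 \<le> C" "\<And>\<omega>. 0 \<le> \<omega> \<Longrightarrow> norm (g \<omega>) \<le> C * exp (max q 0 * \<omega>)"
proof -
  obtain C1 :: real where C1: "Limsup at_top (\<lambda>\<omega>. ereal (norm (g \<omega>) / exp (q * \<omega>))) < C1"
    using ereal_dense2[OF L] by blast
  have "\<forall>\<^sub>F \<omega> in at_top. norm (g \<omega>) / exp (q * \<omega>) < C1"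
    using Limsup_lessD[OF C1] by simp
  then obtain R where R: "\<And>\<omega>. R \<le> \<omega> \<Longrightarrow> norm (g \<omega>) / exp (q * \<omega>) < C1"
    by (auto simp: eventually_at_top_linorder)
  have "bounded (g ` {0..R})"
    using assms(1) by (intro compact_imp_bounded compact_continuous_image) (auto intro: continuous_on_subset)
  then obtain C2 where C2: "\<And>\<omega>. \<omega> \<in> {0..R} \<Longrightarrow> norm (g \<omega>) \<le> C2"
    unfolding bounded_iff by blast
  define C where "C = max 0 (max C1 C2)"
  have "norm (g \<omega>) \<le> C * exp (max q 0 * \<omega>)" if "0 \<le> \<omega>" for \<omega>
  proof (cases "R \<le> \<omega>")
    case True
    have "norm (g \<omega>) \<le> C1 * exp (q * \<omega>)" using R[OF True] by (simp add: field_simps)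
    also have "\<dots> \<le> C * exp (max q 0 * \<omega>)"
      using that by (intro mult_mono) (auto simp: C_def mult_right_mono)
    finally show ?thesis .
  next
    case False
    then have "norm (g \<omega>) \<le> C * 1" using C2[of \<omega>] that by (auto simp: C_def)
    also have "\<dots> \<le> C * exp (max q 0 * \<omega>)"
      using that by (intro mult_left_mono) (auto simp: C_def)
    finally show ?thesis .
  qed
  then show thesis using that[of C] by (auto simp: C_def)
qed

section \<open>Defining functions and the outer unit normal\<close>

text \<open>Along a direction \<open>h\<close> transversal to the boundary, \<open>\<phi>\<close>
  starts at 0 with slope \<open>G x \<bullet> h\<close>, whose sign decides on which side the ray
  starts.\<close>

lemma defining_function_sign:
  assumes "C2_defining_function \<Omega> U \<phi> G" "x \<in> U" "x \<in> frontier \<Omega>" "G x \<bullet> h \<noteq> 0"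
  obtains \<delta> where "0 < \<delta>"
    "\<And>s. 0 < s \<Longrightarrow> s \<le> \<delta> \<Longrightarrow> x + s *\<^sub>R h \<in> \<Omega> \<longleftrightarrow> G x \<bullet> h < 0"
proof -
  have U: "open U" and \<phi>: "(\<phi> has_derivative (\<lambda>h. G x \<bullet> h)) (at x)" "\<phi> x = 0"
    and neg: "\<And>y. y \<in> U \<Longrightarrow> y \<in> \<Omega> \<longleftrightarrow> \<phi> y < 0"
    using assms(1-3) unfolding C2_defining_function_def by auto
  have "((\<lambda>s. \<phi> (x + s *\<^sub>R h)) has_derivative (\<lambda>s. G x \<bullet> (s *\<^sub>R h))) (at 0)"
    by (rule has_derivative_compose[where f = "\<lambda>s. x + s *\<^sub>R h" and f' = "\<lambda>s. s *\<^sub>R h" and g = \<phi>])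
       (auto intro!: derivative_eq_intros \<phi>)
  then have \<phi>': "((\<lambda>s. \<phi> (x + s *\<^sub>R h)) has_real_derivative (G x \<bullet> h)) (at 0)"
    by (simp add: has_field_derivative_def mult.commute[of _ "G x \<bullet> h"])
  obtain d1 where d1: "d1 > 0"
    "\<And>s. 0 < s \<Longrightarrow> s < d1 \<Longrightarrow> \<phi> (x + s *\<^sub>R h) < 0 \<longleftrightarrow> G x \<bullet> h < 0"
  proof (cases "G x \<bullet> h < 0")
    case True
    show thesis using DERIV_neg_dec_right[OF \<phi>' True] that \<phi>(2) True by auto
  next
    case False
    then have "0 < G x \<bullet> h" using assms(4) by simp
    from DERIV_pos_inc_right[OF \<phi>' this] that \<phi>(2) False show thesis by (auto dest: less_asym)
  qed
  have "((\<lambda>s. x + s *\<^sub>R h) \<longlongrightarrow> x + 0 *\<^sub>R h) (at 0)" by (intro tendsto_intros)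
  then have "\<forall>\<^sub>F s in at 0. x + s *\<^sub>R h \<in> U"
    using topological_tendstoD[OF _ U] assms(2) by fastforce
  then obtain d2 where d2: "d2 > 0" "\<And>s. s \<noteq> 0 \<Longrightarrow> \<bar>s\<bar> < d2 \<Longrightarrow> x + s *\<^sub>R h \<in> U"
    by (auto simp: eventually_at)
  show thesis
    by (rule that[of "min d1 d2 / 2"]) (use d1 d2 in \<open>auto simp: neg\<close>)
qed

text \<open>If the unit gradients \<open>a\<close> and \<open>b\<close> differed, then \<open>b - a\<close> would point into \<open>\<Omega>\<close> according to
  one defining function and out of it according to the other.\<close>

lemma defining_function_normal_unique:
  assumes "C2_defining_function \<Omega> U \<phi> G" "x \<in> U"
    and "C2_defining_function \<Omega> V \<psi> H" "x \<in> V" and "x \<in> frontier \<Omega>"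
  shows "G x /\<^sub>R norm (G x) = H x /\<^sub>R norm (H x)"
proof (rule ccontr)
  define a where "a = G x /\<^sub>R norm (G x)"
  define b where "b = H x /\<^sub>R norm (H x)"
  assume "\<not> ?thesis"
  then have "a \<noteq> b" by (simp add: a_def b_def)
  have nz: "G x \<noteq> 0" "H x \<noteq> 0" using assms by (auto simp: C2_defining_function_def)
  then have u: "a \<bullet> a = 1" "b \<bullet> b = 1"
    by (auto simp: a_def b_def dot_square_norm power2_eq_square)
  \<comment> \<open>Distinct unit vectors have inner product below 1, which makes both signs for
    \<open>b - a\<close> strict.\<close>
  have "0 < (a - b) \<bullet> (a - b)" using \<open>a \<noteq> b\<close> by simp
  then have ab: "a \<bullet> b < 1" using u by (simp add: inner_diff inner_commute)
  have G: "G x \<bullet> h = norm (G x) * (a \<bullet> h)" and H: "H x \<bullet> h = norm (H x) * (b \<bullet> h)" for h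
    using nz by (auto simp: a_def b_def)
  have sgn: "G x \<bullet> (b - a) < 0" "0 < H x \<bullet> (b - a)"
    using ab u nz unfolding G H by (auto simp: inner_diff inner_commute mult_pos_neg)
  obtain d where d: "0 < d" "\<And>s. 0 < s \<Longrightarrow> s \<le> d \<Longrightarrow> x + s *\<^sub>R (b - a) \<in> \<Omega>"
    using defining_function_sign[OF assms(1,2,5), of "b - a"] sgn by auto
  obtain e where e: "0 < e" "\<And>s. 0 < s \<Longrightarrow> s \<le> e \<Longrightarrow> x + s *\<^sub>R (b - a) \<notin> \<Omega>"
    using defining_function_sign[OF assms(3-5), of "b - a"] sgn by auto
  show False
    using d(1) e(1) d(2)[of "min d e"] e(2)[of "min d e"] by auto
qed

section \<open>Cutoffs and a function with positive normal derivative on the boundary\<close>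

text \<open>A truncated paraboloid in place of a smooth bump: it has a kink on the sphere, but its
  cube is of class \<open>C\<^sup>2\<close> with explicit derivatives.\<close>

definition cutoff :: "'a::euclidean_space \<Rightarrow> real \<Rightarrow> 'a \<Rightarrow> real" where
  "cutoff a r y = max 0 (r\<^sup>2 - (y - a) \<bullet> (y - a))"

lemma continuous_on_cutoff [continuous_intros]: "continuous_on S (cutoff a r)"
  unfolding cutoff_def by (intro continuous_intros)

lemma cutoff_nonneg [simp]: "0 \<le> cutoff a r y"
  by (simp add: cutoff_def)

lemma cutoff_pos_iff: "0 < r \<Longrightarrow> 0 < cutoff a r y \<longleftrightarrow> y \<in> ball a r"
proof -
  assume "0 < r"
  have "0 < cutoff a r y \<longleftrightarrow> (norm (y - a))\<^sup>2 < r\<^sup>2"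
    by (auto simp: cutoff_def dot_square_norm)
  also have "\<dots> \<longleftrightarrow> norm (y - a) < r"
    using \<open>0 < r\<close> by (auto intro: power2_less_imp_less power_strict_mono)
  finally show ?thesis by (simp add: dist_norm norm_minus_commute)
qed

lemma cutoff_eq_0: "0 < r \<Longrightarrow> y \<notin> ball a r \<Longrightarrow> cutoff a r y = 0"
  using cutoff_pos_iff[of r a y] cutoff_nonneg[of a r y] by linarith

lemma has_real_derivative_max_0_power:
  assumes "2 \<le> n"
  shows "((\<lambda>s::real. max 0 s ^ n) has_real_derivative real n * max 0 s ^ (n - 1)) (at s)"
proof -
  consider "s < 0" | "s = 0" | "0 < s" by linarith
  then show ?thesis
  proof cases
    case 1
    have "((\<lambda>s::real. 0) has_real_derivative 0) (at s)" by simp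
    then have "((\<lambda>s::real. max 0 s ^ n) has_real_derivative 0) (at s)"
      by (rule DERIV_cong_ev[THEN iffD1, rotated -1])
         (use 1 assms in \<open>auto simp: power_0_left intro!: eventually_mono[OF eventually_nhds_in_open[of "{..<0}"]]\<close>)
    then show ?thesis using 1 assms by (simp add: power_0_left)
  next
    case 2
    \<comment> \<open>At the kink the difference quotient is \<open>h ^ (n - 1)\<close> or 0.
      Writing \<open>n = k + 2\<close> exhibits a positive exponent, hence the limit 0.\<close>
    obtain k where n: "n = Suc (Suc k)" using assms by (metis Suc_le_D numeral_2_eq_2 Suc_le_mono)
    have "((\<lambda>h::real. max 0 h ^ Suc k * (if 0 < h then 1 else 0)) \<longlongrightarrow> 0) (at 0)"
    proof (rule Lim_null_comparison)
      show "((\<lambda>h::real. \<bar>h\<bar> ^ Suc k) \<longlongrightarrow> 0) (at 0)" by (rule tendsto_eq_intros refl | simp)+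
      have "norm (max 0 h ^ Suc k * (if 0 < h then 1 else 0)) \<le> \<bar>h\<bar> ^ Suc k" for h :: real
        by (cases "0 < h") (simp_all del: power_Suc)
      then show "\<forall>\<^sub>F h in at 0. norm (max 0 h ^ Suc k * (if 0 < h then 1 else 0)) \<le> \<bar>h\<bar> ^ Suc k"
        by (intro always_eventually allI)
    qed
    moreover have "(max 0 h ^ n) / h = max 0 h ^ Suc k * (if 0 < h then 1 else 0)" for h :: real
      by (auto simp: n max_def)
    ultimately show ?thesis by (simp add: 2 DERIV_def n)
  next
    case 3
    have "((\<lambda>s::real. s ^ n) has_real_derivative real n * s ^ (n - 1)) (at s)"
      by (auto intro!: derivative_eq_intros)
    then have "((\<lambda>s::real. max 0 s ^ n) has_real_derivative real n * s ^ (n - 1)) (at s)"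
      by (rule DERIV_cong_ev[THEN iffD1, rotated -1])
         (use 3 in \<open>auto intro!: eventually_mono[OF eventually_nhds_in_open[of "{0<..}"]]\<close>)
    then show ?thesis using 3 by (simp add: max_def)
  qed
qed

lemma has_derivative_cutoff_power:
  assumes "2 \<le> n"
  shows "((\<lambda>y. cutoff a r y ^ n) has_derivative
     (\<lambda>h. (- 2 * real n * cutoff a r y ^ (n - 1)) * ((y - a) \<bullet> h))) (at y)"
proof -
  have "((\<lambda>y. r\<^sup>2 - (y - a) \<bullet> (y - a)) has_derivative (\<lambda>h. - 2 * ((y - a) \<bullet> h))) (at y)"
    by (auto intro!: derivative_eq_intros simp: inner_commute)
  from has_derivative_compose[OF this
      has_real_derivative_max_0_power[OF assms, unfolded has_field_derivative_def]]
  show ?thesis by (simp add: cutoff_def mult_ac)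
qed

definition cutoff3_grad :: "'a::euclidean_space \<Rightarrow> real \<Rightarrow> 'a \<Rightarrow> 'a" where
  "cutoff3_grad a r y = (- 6 * cutoff a r y ^ 2) *\<^sub>R (y - a)"

definition cutoff3_hess :: "'a::euclidean_space \<Rightarrow> real \<Rightarrow> 'a \<Rightarrow> 'a \<Rightarrow> 'a" where
  "cutoff3_hess a r y h =
     (24 * cutoff a r y * ((y - a) \<bullet> h)) *\<^sub>R (y - a) - (6 * cutoff a r y ^ 2) *\<^sub>R h"

lemma has_derivative_cutoff3:
  "((\<lambda>y. cutoff a r y ^ 3) has_derivative (\<lambda>h. cutoff3_grad a r y \<bullet> h)) (at y)"
  using has_derivative_cutoff_power[of 3 a r y] by (simp add: cutoff3_grad_def)

lemma has_derivative_cutoff3_grad: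
  "(cutoff3_grad a r has_derivative cutoff3_hess a r y) (at y)"
proof -
  have "((\<lambda>y. (- 6 * cutoff a r y ^ 2) *\<^sub>R (y - a)) has_derivative
     (\<lambda>h. (- 6 * cutoff a r y ^ 2) *\<^sub>R h +
       (- 6 * ((- 2 * real 2 * cutoff a r y ^ (2 - 1)) * ((y - a) \<bullet> h))) *\<^sub>R (y - a))) (at y)"
    by (rule has_derivative_scaleR has_derivative_mult_right has_derivative_cutoff_power order_refl
        | auto intro!: derivative_eq_intros)+
  then show ?thesis
    by (simp add: cutoff3_grad_def[abs_def] cutoff3_hess_def[abs_def] algebra_simps)
qed

text \<open>The function is a defining function times a cubed cutoff, so that it is twice differentiable on the
  whole space.  On the boundary the gradient of the cutoff drops out.\<close>

lemma local_boundary_function: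
  fixes \<Omega> :: "'a::euclidean_space set"
  assumes "outer_unit_normal \<Omega> \<nu>" "a \<in> frontier \<Omega>"
  obtains \<psi> D H B r where "0 < r"
    "\<And>y. (\<psi> has_derivative (\<lambda>h. D y \<bullet> h)) (at y)"
    "\<And>y. (D has_derivative H y) (at y)"
    "\<And>y. \<bar>\<Sum>b\<in>Basis. H y b \<bullet> b\<bar> \<le> B"
    "\<And>y. y \<in> frontier \<Omega> \<Longrightarrow> \<exists>c\<ge>0. D y = c *\<^sub>R \<nu> y \<and> (y \<in> ball a r \<longrightarrow> 0 < c)"
proof -
  obtain U \<phi> G where U: "a \<in> U" and df: "C2_defining_function \<Omega> U \<phi> G"
    using assms unfolding outer_unit_normal_def by blast
  have "open U" and \<phi>: "\<And>y. y \<in> U \<Longrightarrow> (\<phi> has_derivative (\<lambda>h. G y \<bullet> h)) (at y)"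
    and G0: "\<And>y. y \<in> U \<Longrightarrow> G y \<noteq> 0"
    and \<phi>0: "\<And>y. y \<in> U \<Longrightarrow> y \<in> frontier \<Omega> \<Longrightarrow> \<phi> y = 0"
    using df unfolding C2_defining_function_def by auto
  obtain K :: "'a \<Rightarrow> 'a \<Rightarrow>\<^sub>L 'a" where K: "continuous_on U K"
    and GK: "\<And>y. y \<in> U \<Longrightarrow> (G has_derivative K y) (at y)"
    using df unfolding C2_defining_function_def by blast
  obtain r where r: "0 < r" "cball a r \<subseteq> U" using \<open>open U\<close> U open_contains_cball by blast
  \<comment> \<open>Outside \<open>U\<close> nothing is known about \<open>\<phi>\<close>, hence the
    default 0. It fits, since the cutoff and with it all three expressions vanish off
    \<open>cball a r\<close>, which lies in \<open>U\<close>.\<close>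
  define \<psi> where "\<psi> y = (if y \<in> U then cutoff a r y ^ 3 * \<phi> y else 0)" for y
  define D where "D y = (if y \<in> U then \<phi> y *\<^sub>R cutoff3_grad a r y + cutoff a r y ^ 3 *\<^sub>R G y else 0)" for y
  define H where "H y h = (if y \<in> U then
      (G y \<bullet> h) *\<^sub>R cutoff3_grad a r y + \<phi> y *\<^sub>R cutoff3_hess a r y h
      + (cutoff3_grad a r y \<bullet> h) *\<^sub>R G y + cutoff a r y ^ 3 *\<^sub>R blinfun_apply (K y) h else 0)" for y h
  have out: "\<psi> y = 0" "D y = 0" "H y = (\<lambda>h. 0)" if "y \<notin> cball a r" for y
  proof -
    have "cutoff a r y = 0" using that r(1) by (intro cutoff_eq_0) auto
    then show "\<psi> y = 0" "D y = 0" "H y = (\<lambda>h. 0)"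
      by (auto simp: \<psi>_def D_def H_def cutoff3_grad_def cutoff3_hess_def)
  qed
  \<comment> \<open>The open sets \<open>U\<close> and \<open>- cball a r\<close> cover the space,
    so differentiability can be checked on each of them.\<close>
  have oc: "open (- cball a r)" by (simp add: open_Compl)
  have d1: "(\<psi> has_derivative (\<lambda>h. D y \<bullet> h)) (at y)" for y
  proof (cases "y \<in> U")
    case True
    have "((\<lambda>y. cutoff a r y ^ 3 * \<phi> y) has_derivative
       (\<lambda>h. cutoff a r y ^ 3 * (G y \<bullet> h) + (cutoff3_grad a r y \<bullet> h) * \<phi> y)) (at y)"
      by (intro has_derivative_mult has_derivative_cutoff3 \<phi> True)
    then have "(\<psi> has_derivative (\<lambda>h. cutoff a r y ^ 3 * (G y \<bullet> h) + (cutoff3_grad a r y \<bullet> h) * \<phi> y)) (at y)"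
      by (rule has_derivative_transform_within_open[OF _ \<open>open U\<close> True]) (simp add: \<psi>_def)
    then show ?thesis using True by (simp add: D_def inner_add algebra_simps)
  next
    case False
    then have y: "y \<in> - cball a r" using r by auto
    have "((\<lambda>_. 0) has_derivative (\<lambda>h. D y \<bullet> h)) (at y)" using out y by simp
    then show ?thesis
      by (rule has_derivative_transform_within_open[OF _ oc y]) (simp add: out)
  qed
  have d2: "(D has_derivative H y) (at y)" for y
  proof (cases "y \<in> U")
    case True
    have "((\<lambda>y. \<phi> y *\<^sub>R cutoff3_grad a r y + cutoff a r y ^ 3 *\<^sub>R G y) has_derivative
       (\<lambda>h. (\<phi> y *\<^sub>R cutoff3_hess a r y h + (G y \<bullet> h) *\<^sub>R cutoff3_grad a r y)
         + (cutoff a r y ^ 3 *\<^sub>R blinfun_apply (K y) h + (cutoff3_grad a r y \<bullet> h) *\<^sub>R G y))) (at y)"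
      by (intro has_derivative_add has_derivative_scaleR has_derivative_cutoff3
          has_derivative_cutoff3_grad \<phi> GK True)
    then have "(D has_derivative (\<lambda>h. (\<phi> y *\<^sub>R cutoff3_hess a r y h + (G y \<bullet> h) *\<^sub>R cutoff3_grad a r y)
         + (cutoff a r y ^ 3 *\<^sub>R blinfun_apply (K y) h + (cutoff3_grad a r y \<bullet> h) *\<^sub>R G y))) (at y)"
      by (rule has_derivative_transform_within_open[OF _ \<open>open U\<close> True]) (simp add: D_def)
    then show ?thesis using True by (simp add: H_def[abs_def] algebra_simps)
  next
    case False
    then have y: "y \<in> - cball a r" using r by auto
    have "((\<lambda>_. 0) has_derivative H y) (at y)" using out(3)[of y] y by simp
    then show ?thesis
      by (rule has_derivative_transform_within_open[OF _ oc y]) (simp add: out)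
  qed
  \<comment> \<open>Continuity of the Hessian \<open>K\<close> enters here: it bounds the trace on
    the compact ball, and outside the trace is 0.\<close>
  have c\<phi>: "continuous_on (cball a r) \<phi>" "continuous_on (cball a r) G"
    using r(2) \<phi> GK
    by (auto intro!: continuous_at_imp_continuous_on intro: has_derivative_continuous)
  have "continuous_on (cball a r) (\<lambda>y. \<Sum>b\<in>Basis. ((G y \<bullet> b) *\<^sub>R cutoff3_grad a r y + \<phi> y *\<^sub>R cutoff3_hess a r y b
      + (cutoff3_grad a r y \<bullet> b) *\<^sub>R G y + cutoff a r y ^ 3 *\<^sub>R blinfun_apply (K y) b) \<bullet> b)"
    unfolding cutoff3_grad_def cutoff3_hess_def
    by (intro continuous_intros c\<phi> continuous_on_subset[OF K r(2)])
  then have "continuous_on (cball a r) (\<lambda>y. \<Sum>b\<in>Basis. H y b \<bullet> b)"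
    using r(2) by (elim continuous_on_eq) (auto simp: H_def subset_iff)
  then have "bounded ((\<lambda>y. \<Sum>b\<in>Basis. H y b \<bullet> b) ` cball a r)"
    by (intro compact_imp_bounded compact_continuous_image compact_cball)
  then obtain B where B: "\<And>y. y \<in> cball a r \<Longrightarrow> \<bar>\<Sum>b\<in>Basis. H y b \<bullet> b\<bar> \<le> B"
    unfolding bounded_iff by fastforce
  have "0 \<le> B" using B[of a] r(1) by auto
  have "\<bar>\<Sum>b\<in>Basis. H y b \<bullet> b\<bar> \<le> B" for y
    using B[of y] out(3)[of y] \<open>0 \<le> B\<close> by (cases "y \<in> cball a r") auto
  moreover have "\<exists>c\<ge>0. D y = c *\<^sub>R \<nu> y \<and> (y \<in> ball a r \<longrightarrow> 0 < c)" if y: "y \<in> frontier \<Omega>" for y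
  proof (cases "y \<in> U")
    case True
    \<comment> \<open>The normal at \<open>y\<close> may come from another defining function;
      uniqueness identifies it with the normalized \<open>G y\<close>.\<close>
    obtain V \<phi>' G' where "y \<in> V" "C2_defining_function \<Omega> V \<phi>' G'" and \<nu>: "\<nu> y = G' y /\<^sub>R norm (G' y)"
      using assms(1) y unfolding outer_unit_normal_def by blast
    then have "G y /\<^sub>R norm (G y) = \<nu> y"
      unfolding \<nu> by (intro defining_function_normal_unique[OF df True _ _ y])
    then have "norm (G y) *\<^sub>R \<nu> y = norm (G y) *\<^sub>R (G y /\<^sub>R norm (G y))" by simp
    then have G: "norm (G y) *\<^sub>R \<nu> y = G y" using G0[OF True] by simp
    show ?thesis
      using True y G0[OF True] cutoff_pos_iff[OF r(1), of a y]
      by (intro exI[of _ "cutoff a r y ^ 3 * norm (G y)"])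
         (auto simp: D_def \<phi>0 G simp flip: scaleR_scaleR)
  next
    case False
    then have "y \<notin> ball a r" using r(2) ball_subset_cball by blast
    with False show ?thesis by (intro exI[of _ 0]) (simp add: D_def)
  qed
  ultimately show thesis
    using that[OF r(1) d1 d2] by blast
qed

text \<open>Finitely many local functions, whose balls cover the compact boundary, are added. On the
  boundary their gradients are nonnegative multiples of the same vector \<open>\<nu> y\<close>, so
  nothing cancels, and at each point at least one multiple is positive. Compactness then yields
  \<open>m\<close>.\<close>

lemma boundary_function:
  fixes \<Omega> :: "'a::euclidean_space set"
  assumes "outer_unit_normal \<Omega> \<nu>" "bounded \<Omega>"
  obtains m M \<psi> D H where "0 < m" "0 \<le> M"
    "\<And>y. (\<psi> has_derivative (\<lambda>h. D y \<bullet> h)) (at y)"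
    "\<And>y. (D has_derivative H y) (at y)"
    "\<And>y. y \<in> closure \<Omega> \<Longrightarrow> \<bar>\<psi> y\<bar> \<le> M" "\<And>y. y \<in> closure \<Omega> \<Longrightarrow> norm (D y) \<le> M"
    "\<And>y. \<bar>\<Sum>b\<in>Basis. H y b \<bullet> b\<bar> \<le> M"
    "\<And>y. y \<in> frontier \<Omega> \<Longrightarrow> m \<le> D y \<bullet> \<nu> y"
proof -
  \<comment> \<open>The local data form one tuple, so that a single choice over the boundary points
    supplies all of them.\<close>
  let ?L = "\<lambda>a (\<psi>, D, H, B, r). 0 < r \<and>
    (\<forall>y. (\<psi> has_derivative (\<lambda>h. D y \<bullet> h)) (at y)) \<and> (\<forall>y. (D has_derivative H y) (at y)) \<and>
    (\<forall>y. \<bar>\<Sum>b\<in>Basis. H y b \<bullet> b\<bar> \<le> B) \<and>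
    (\<forall>y\<in>frontier \<Omega>. \<exists>c\<ge>0. D y = c *\<^sub>R \<nu> y \<and> (y \<in> ball a r \<longrightarrow> 0 < c))"
  have "\<forall>a\<in>frontier \<Omega>. \<exists>w. ?L a w"
  proof
    fix a assume a: "a \<in> frontier \<Omega>"
    show "\<exists>w. ?L a w"
    proof (rule local_boundary_function[OF assms(1) a])
      fix \<psi> D H B r
      assume "0 < r" "\<And>y. (\<psi> has_derivative (\<lambda>h. D y \<bullet> h)) (at y)" "\<And>y. (D has_derivative H y) (at y)"
        "\<And>y. \<bar>\<Sum>b\<in>Basis. H y b \<bullet> b\<bar> \<le> B"
        "\<And>y. y \<in> frontier \<Omega> \<Longrightarrow> \<exists>c\<ge>0. D y = c *\<^sub>R \<nu> y \<and> (y \<in> ball a r \<longrightarrow> 0 < c)"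
      then have "?L a (\<psi>, D, H, B, r)" unfolding prod.case by (intro conjI allI ballI)
      then show ?thesis by (rule exI)
    qed
  qed
  then obtain W where W: "\<forall>a\<in>frontier \<Omega>. ?L a (W a)" by (elim bchoice[THEN exE])
  define \<psi> where "\<psi> a = fst (W a)" for a
  define D where "D a = fst (snd (W a))" for a
  define H where "H a = fst (snd (snd (W a)))" for a
  define B where "B a = fst (snd (snd (snd (W a))))" for a
  define r where "r a = snd (snd (snd (snd (W a))))" for a
  have L: "0 < r a" "(\<psi> a has_derivative (\<lambda>h. D a y \<bullet> h)) (at y)"
    "(D a has_derivative H a y) (at y)" "\<bar>\<Sum>b\<in>Basis. H a y b \<bullet> b\<bar> \<le> B a"
    "y \<in> frontier \<Omega> \<Longrightarrow> \<exists>c\<ge>0. D a y = c *\<^sub>R \<nu> y \<and> (y \<in> ball a (r a) \<longrightarrow> 0 < c)"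
    if "a \<in> frontier \<Omega>" for a y
    using bspec[OF W that] unfolding \<psi>_def D_def H_def B_def r_def case_prod_beta by blast+
  have cF: "compact (frontier \<Omega>)" using assms(2) by (rule compact_frontier_bounded)
  obtain A where A: "A \<subseteq> frontier \<Omega>" "finite A" "frontier \<Omega> \<subseteq> (\<Union>a\<in>A. ball a (r a))"
    by (rule compactE_image[OF cF, of "frontier \<Omega>" "\<lambda>a. ball a (r a)"]) (use L(1) in auto)
  define \<psi>s where "\<psi>s y = (\<Sum>a\<in>A. \<psi> a y)" for y
  define Ds where "Ds y = (\<Sum>a\<in>A. D a y)" for y
  define Hs where "Hs y h = (\<Sum>a\<in>A. H a y h)" for y h
  have d1: "(\<psi>s has_derivative (\<lambda>h. Ds y \<bullet> h)) (at y)" for y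
    unfolding \<psi>s_def Ds_def inner_sum_left using A(1) by (intro has_derivative_sum L(2)) auto
  have d2: "(Ds has_derivative Hs y) (at y)" for y
    unfolding Hs_def[abs_def] Ds_def[abs_def] using A(1) by (intro has_derivative_sum L(3)) auto
  have tr: "\<bar>\<Sum>b\<in>Basis. Hs y b \<bullet> b\<bar> \<le> (\<Sum>a\<in>A. B a)" for y
  proof -
    have "(\<Sum>b\<in>Basis. Hs y b \<bullet> b) = (\<Sum>a\<in>A. \<Sum>b\<in>Basis. H a y b \<bullet> b)"
      unfolding Hs_def inner_sum_left by (rule sum.swap)
    also have "\<bar>\<dots>\<bar> \<le> (\<Sum>a\<in>A. B a)"
      using A(1) by (intro order_trans[OF sum_abs] sum_mono L(4)) auto
    finally show ?thesis .
  qed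
  have cont: "continuous_on S \<psi>s" "continuous_on S Ds" for S
    using d1 d2 by (auto intro!: continuous_at_imp_continuous_on intro: has_derivative_continuous)
  have cC: "compact (closure \<Omega>)" using assms(2) by (simp add: compact_closure)
  obtain M1 where M1: "\<And>y. y \<in> closure \<Omega> \<Longrightarrow> \<bar>\<psi>s y\<bar> \<le> M1"
    using compact_imp_bounded[OF compact_continuous_image[OF cont(1) cC]] unfolding bounded_iff by auto
  obtain M2 where M2: "\<And>y. y \<in> closure \<Omega> \<Longrightarrow> norm (Ds y) \<le> M2"
    using compact_imp_bounded[OF compact_continuous_image[OF cont(2) cC]] unfolding bounded_iff by auto
  have bdry: "Ds y \<noteq> 0 \<and> Ds y \<bullet> \<nu> y = norm (Ds y)" if y: "y \<in> frontier \<Omega>" for y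
  proof -
    have "\<forall>a\<in>A. \<exists>c\<ge>0. D a y = c *\<^sub>R \<nu> y \<and> (y \<in> ball a (r a) \<longrightarrow> 0 < c)"
      using L(5) A(1) y by blast
    then obtain c where c: "\<And>a. a \<in> A \<Longrightarrow> 0 \<le> c a" "\<And>a. a \<in> A \<Longrightarrow> D a y = c a *\<^sub>R \<nu> y"
      "\<And>a. a \<in> A \<Longrightarrow> y \<in> ball a (r a) \<Longrightarrow> 0 < c a"
      by metis
    obtain a where "a \<in> A" "y \<in> ball a (r a)" using A(3) y by blast
    then have pos: "0 < sum c A" using c A(2) by (intro sum_pos2[of A a]) auto
    have D: "Ds y = sum c A *\<^sub>R \<nu> y" by (simp add: Ds_def c(2) scaleR_left.sum)
    obtain U \<phi> G where "y \<in> U" "C2_defining_function \<Omega> U \<phi> G" "\<nu> y = G y /\<^sub>R norm (G y)"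
      using assms(1) y unfolding outer_unit_normal_def by blast
    then have "norm (\<nu> y) = 1" by (auto simp: C2_defining_function_def)
    then show ?thesis using pos by (auto simp: D dot_square_norm)
  qed
  \<comment> \<open>The normal is prescribed only pointwise, but on the boundary
    \<open>Ds y \<bullet> \<nu> y\<close> is the norm of the continuous \<open>Ds\<close>, whose
    minimum is attained. For an empty boundary any positive \<open>m\<close> serves.\<close>
  obtain m where m: "0 < m" "\<And>y. y \<in> frontier \<Omega> \<Longrightarrow> m \<le> norm (Ds y)"
  proof (cases "frontier \<Omega> = {}")
    case False
    obtain z where "z \<in> frontier \<Omega>" "\<And>y. y \<in> frontier \<Omega> \<Longrightarrow> norm (Ds z) \<le> norm (Ds y)"
      using continuous_attains_inf[OF cF False continuous_on_norm[OF cont(2)]] by blast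
    then show thesis using that[of "norm (Ds z)"] bdry by auto
  qed (use that[of 1] in auto)
  show thesis
  proof (rule that[OF m(1) _ d1 d2])
    let ?M = "max 0 (max M1 (max M2 (sum B A)))"
    show "0 \<le> ?M" by simp
    show "\<bar>\<psi>s y\<bar> \<le> ?M" "norm (Ds y) \<le> ?M" if "y \<in> closure \<Omega>" for y
      using M1[OF that] M2[OF that] by auto
    show "\<bar>\<Sum>b\<in>Basis. Hs y b \<bullet> b\<bar> \<le> ?M" for y using tr[of y] by auto
    show "m \<le> Ds y \<bullet> \<nu> y" if "y \<in> frontier \<Omega>" for y using m(2) bdry that by auto
  qed
qed

section \<open>Necessary conditions at a spatial minimum\<close>

lemma has_vector_derivative_along_line:
  assumes "(f has_derivative f') (at (x + s *\<^sub>R b))"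
  shows "((\<lambda>s. f (x + s *\<^sub>R b)) has_vector_derivative f' b) (at s)"
proof -
  have "((\<lambda>s. x + s *\<^sub>R b) has_derivative (\<lambda>s. s *\<^sub>R b)) (at s)"
    by (auto intro!: derivative_eq_intros)
  from has_derivative_compose[OF this assms] show ?thesis
    using linear_scale[OF has_derivative_linear[OF assms]]
    by (simp add: has_vector_derivative_def)
qed

text \<open>The second-derivative test applies along each coordinate line, where
  \<open>L b \<bullet> b\<close> is the second derivative; the sum over \<open>Basis\<close> is the
  Laplacian.\<close>

lemma interior_min:
  fixes f :: "'a::euclidean_space \<Rightarrow> real"
  assumes "open U" "x \<in> U"
    and f: "\<And>y. y \<in> U \<Longrightarrow> (f has_derivative (\<lambda>h. F y \<bullet> h)) (at y)"
    and F: "(F has_derivative L) (at x)"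
    and min: "\<And>y. y \<in> U \<Longrightarrow> f x \<le> f y"
  shows "F x = 0" "0 \<le> (\<Sum>b\<in>Basis. L b \<bullet> b)"
proof -
  have "(\<lambda>h. F x \<bullet> h) = (\<lambda>h. 0)"
    using differential_zero_maxmin[OF assms(2,1) f[OF assms(2)]] min by blast
  then show "F x = 0" by (metis inner_eq_zero_iff)
  obtain \<delta> where \<delta>: "0 < \<delta>" "ball x \<delta> \<subseteq> U" using assms(1,2) open_contains_ball by blast
  show "0 \<le> (\<Sum>b\<in>Basis. L b \<bullet> b)"
  proof (rule sum_nonneg)
    fix b :: 'a assume b: "b \<in> Basis"
    have U: "x + s *\<^sub>R b \<in> U" if "\<bar>s\<bar> < \<delta>" for s
      using \<delta>(2) that b by (auto simp: dist_norm subset_iff)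
    show "0 \<le> L b \<bullet> b"
    proof (rule second_deriv_nonneg_at_local_min[OF \<delta>(1)])
      show "((\<lambda>s. f (x + s *\<^sub>R b)) has_real_derivative F (x + s *\<^sub>R b) \<bullet> b) (at s)" if "\<bar>s\<bar> < \<delta>" for s
        using has_vector_derivative_along_line[OF f[OF U[OF that]]]
        by (simp add: has_real_derivative_iff_has_vector_derivative)
      have "((\<lambda>s. F (x + s *\<^sub>R b)) has_vector_derivative L b) (at 0)"
        using F by (intro has_vector_derivative_along_line) simp
      then have "((\<lambda>s. F (x + s *\<^sub>R b) \<bullet> b) has_vector_derivative L b \<bullet> b) (at 0)"
        by (rule bounded_linear.has_vector_derivative[OF bounded_linear_inner_left])
      then show "((\<lambda>s. F (x + s *\<^sub>R b) \<bullet> b) has_real_derivative L b \<bullet> b) (at 0)"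
        by (simp add: has_real_derivative_iff_has_vector_derivative)
      show "f (x + 0 *\<^sub>R b) \<le> f (x + s *\<^sub>R b)" if "\<bar>s\<bar> < \<delta>" for s
        using min[OF U[OF that]] by simp
    qed
  qed
qed

text \<open>The ray from \<open>x\<close> along \<open>- \<nu> x\<close> runs into
  \<open>\<Omega>\<close>, so \<open>f\<close> has a one-sided minimum on it, with derivative
  \<open>- (F \<bullet> \<nu> x)\<close>.\<close>

lemma boundary_min:
  fixes f :: "'a::euclidean_space \<Rightarrow> real"
  assumes "outer_unit_normal \<Omega> \<nu>" "x \<in> frontier \<Omega>"
    and f: "(f has_derivative (\<lambda>h. F \<bullet> h)) (at x within closure \<Omega>)"
    and min: "\<And>y. y \<in> closure \<Omega> \<Longrightarrow> f x \<le> f y"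
  shows "F \<bullet> \<nu> x \<le> 0"
proof -
  obtain U \<phi> G where U: "x \<in> U" and df: "C2_defining_function \<Omega> U \<phi> G" and \<nu>: "\<nu> x = G x /\<^sub>R norm (G x)"
    using assms unfolding outer_unit_normal_def by blast
  have "G x \<noteq> 0" using df U by (auto simp: C2_defining_function_def)
  then have "G x \<bullet> (- \<nu> x) < 0" by (simp add: \<nu> dot_square_norm power2_eq_square)
  then obtain \<delta> where \<delta>: "0 < \<delta>" "\<And>s. 0 < s \<Longrightarrow> s \<le> \<delta> \<Longrightarrow> x + s *\<^sub>R (- \<nu> x) \<in> \<Omega>"
    using defining_function_sign[OF df U assms(2), of "- \<nu> x"] by (metis less_irrefl)
  define l where "l s = x + s *\<^sub>R (- \<nu> x)" for s
  have l: "l s \<in> closure \<Omega>" if "s \<in> {0..0 + \<delta>}" for s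
    using \<delta>(2)[of s] that assms(2) closure_subset[of \<Omega>]
    by (cases "s = 0") (auto simp: l_def frontier_def)
  have dl: "(l has_derivative (\<lambda>s. s *\<^sub>R (- \<nu> x))) (at 0 within {0..0 + \<delta>})"
    unfolding l_def[abs_def] by (auto intro!: derivative_eq_intros)
  have "l 0 = x" by (simp add: l_def)
  have "(f has_derivative (\<lambda>h. F \<bullet> h)) (at (l 0) within l ` {0..0 + \<delta>})"
    unfolding \<open>l 0 = x\<close> by (rule has_derivative_subset[OF f]) (use l in auto)
  from diff_chain_within[OF dl this]
  have "((f \<circ> l) has_derivative (\<lambda>s. F \<bullet> (s *\<^sub>R (- \<nu> x)))) (at 0 within {0..0 + \<delta>})"
    by (simp add: o_def)
  then have "((f \<circ> l) has_real_derivative - (F \<bullet> \<nu> x)) (at 0 within {0..0 + \<delta>})"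
    unfolding has_field_derivative_def by (rule has_derivative_eq_rhs) (simp add: fun_eq_iff)
  from deriv_nonneg_at_right_min[OF this \<delta>(1)] show ?thesis
    using min l by (simp add: l_def)
qed

section \<open>Comparison with a subsolution that blows up\<close>

theorem theorem4p3:
  fixes \<Omega> :: "'a::euclidean_space set"
    and \<nu> :: "'a \<Rightarrow> 'a"
    and p q :: real
    and g :: "real \<Rightarrow> 'a"
    and \<sigma> :: "'a \<Rightarrow> real \<Rightarrow> real"
    and u\<^sub>0 :: "'a \<Rightarrow> real"
    and T :: ereal
    and u :: "'a \<Rightarrow> real \<Rightarrow> real"
  assumes "open \<Omega>" and "connected \<Omega>" and "\<Omega> \<noteq> {}" and "bounded \<Omega>"
    and "C2_boundary \<Omega>" and "outer_unit_normal \<Omega> \<nu>"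
    and "p > 0" and "q < p"
    and "g C1_differentiable_on UNIV"
    and "C1_bounded_on (frontier \<Omega> \<times> {0<..}) (\<lambda>(x, t). \<sigma> x t)"
    and "\<forall>x\<in>frontier \<Omega>. \<forall>t>0. \<sigma> x t \<ge> 0"
    and "continuous_on (closure \<Omega>) u\<^sub>0"
    and "\<forall>x\<in>closure \<Omega>. u\<^sub>0 x \<ge> 0" and "\<exists>x\<in>closure \<Omega>. u\<^sub>0 x \<noteq> 0"
    and "Limsup at_top (\<lambda>\<omega>. ereal (norm (g \<omega>) / exp (q * \<omega>))) < \<infinity>"
    and "maximal_classical_solution \<Omega> \<nu> p g \<sigma> u\<^sub>0 T u"
    and "\<forall>x\<in>closure \<Omega>. \<forall>t. 0 < t \<and> ereal t < T \<longrightarrow> u x t > 0"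
  shows "T < \<infinity>"
proof (rule ccontr)
  assume "\<not> T < \<infinity>"
  then have T: "T = \<infinity>" by simp
  have sol: "classical_solution \<Omega> \<nu> p g \<sigma> u\<^sub>0 \<infinity> u"
    using assms(16) by (simp add: maximal_classical_solution_def T)
  have I: "{t. 0 < t \<and> ereal t < \<infinity>} = {0<..}" by auto
  obtain ut Du D2u where C21: "C21_on (closure \<Omega>) {0<..} u ut Du D2u"
    and pde: "\<And>x t. x \<in> closure \<Omega> \<Longrightarrow> 0 < t \<Longrightarrow>
           ut x t = trace_blinfun (D2u x t) - g (u x t) \<bullet> Du x t + exp (p * u x t)"
    and bc: "\<And>x t. x \<in> frontier \<Omega> \<Longrightarrow> 0 < t \<Longrightarrow> \<sigma> x t * ut x t + Du x t \<bullet> \<nu> x = 0"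
    using sol unfolding classical_solution_def I by auto
  have pos: "0 < u x t" if "x \<in> closure \<Omega>" "0 < t" for x t
    using assms(17) that by (simp add: T)
  have cu: "continuous_on (closure \<Omega> \<times> {0<..}) (\<lambda>(x, t). u x t)"
    and ut: "\<And>x t. x \<in> closure \<Omega> \<Longrightarrow> 0 < t \<Longrightarrow> ((\<lambda>s. u x s) has_real_derivative ut x t) (at t)"
    and Du: "\<And>x t. x \<in> closure \<Omega> \<Longrightarrow> 0 < t \<Longrightarrow>
      ((\<lambda>y. u y t) has_derivative (\<lambda>h. Du x t \<bullet> h)) (at x within closure \<Omega>)"
    and D2u: "\<And>x t. x \<in> closure \<Omega> \<Longrightarrow> 0 < t \<Longrightarrow>
      ((\<lambda>y. Du y t) has_derivative blinfun_apply (D2u x t)) (at x within closure \<Omega>)"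
    using C21 unfolding C21_on_def by (auto simp: at_within_open[of _ "{0<..}"])
  have inner_at: "at x within closure \<Omega> = at x" if "x \<in> \<Omega>" for x
    using at_within_open_subset[OF that assms(1) closure_subset] .
  obtain C where C: "0 \<le> C" "\<And>\<omega>. 0 \<le> \<omega> \<Longrightarrow> norm (g \<omega>) \<le> C * exp (max q 0 * \<omega>)"
    using exp_growth_bound[OF C1_differentiable_imp_continuous_on[OF assms(9)] assms(15)] by blast
  have "bounded ((\<lambda>(x, t). \<sigma> x t) ` (frontier \<Omega> \<times> {0<..}))"
    using assms(10) unfolding C1_bounded_on_def by blast
  then obtain S where S0: "0 < S"
    and S': "\<forall>w\<in>(\<lambda>(x, t). \<sigma> x t) ` (frontier \<Omega> \<times> {0<..}). norm w \<le> S"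
    unfolding bounded_pos by blast
  have S: "\<bar>\<sigma> x t\<bar> \<le> S" if "x \<in> frontier \<Omega>" "0 < t" for x t
    using bspec[OF S' imageI[of "(x, t)"]] that by simp
  obtain m M \<psi> D H where m: "0 < m" and M: "0 \<le> M"
    and d\<psi>: "\<And>y. (\<psi> has_derivative (\<lambda>h. D y \<bullet> h)) (at y)"
    and dD: "\<And>y. (D has_derivative H y) (at y)"
    and \<psi>M: "\<And>y. y \<in> closure \<Omega> \<Longrightarrow> \<bar>\<psi> y\<bar> \<le> M" and DM: "\<And>y. y \<in> closure \<Omega> \<Longrightarrow> norm (D y) \<le> M"
    and HM: "\<And>y. \<bar>\<Sum>b\<in>Basis. H y b \<bullet> b\<bar> \<le> M"
    and D\<nu>: "\<And>y. y \<in> frontier \<Omega> \<Longrightarrow> m \<le> D y \<bullet> \<nu> y"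
    by (fact boundary_function[OF assms(6,4)])
  \<comment> \<open>Since \<open>p - \<alpha> = max q 0\<close>, the reaction times
    \<open>exp (- \<alpha> * u)\<close> grows at the same rate as the bound for
    \<open>g\<close>.\<close>
  define \<alpha> where "\<alpha> = p - max q 0"
  have \<alpha>: "0 < \<alpha>" using assms(7,8) by (simp add: \<alpha>_def)
  \<comment> \<open>The denominator accounts for the Laplacian \<open>\<epsilon> * M\<close>, the
    convection \<open>C * (\<epsilon> * M)\<close>, one \<open>\<epsilon>\<close> for
    \<open>\<kappa>\<close>, and another as the margin that makes \<open>\<kappa>\<alpha>\<close>
    strict.\<close>
  define \<epsilon> where "\<epsilon> = \<alpha> / (2 + M + C * M)"
  \<comment> \<open>The minimum gives \<open>\<kappa> \<le> \<epsilon>\<close> for the interior and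
    \<open>(S + 1) * \<kappa> \<le> \<epsilon> * m\<close> for the boundary; the summand 1 makes
    \<open>S\<kappa>\<close> strict.\<close>
  define \<kappa> where "\<kappa> = \<epsilon> * min 1 (m / (S + 1))"
  have den: "0 < 2 + M + C * M" using M C(1) by (simp add: add_pos_nonneg)
  then have \<epsilon>: "0 < \<epsilon>" using \<alpha> by (simp add: \<epsilon>_def)
  have \<kappa>: "0 < \<kappa>" using \<epsilon> m S0 by (simp add: \<kappa>_def)
  have "\<epsilon> * (2 + M + C * M) = \<alpha>" using den by (simp add: \<epsilon>_def)
  moreover have "\<kappa> \<le> \<epsilon>" using \<epsilon> by (simp add: \<kappa>_def mult_left_le)
  ultimately have \<kappa>\<alpha>: "\<kappa> + \<epsilon> * M + C * (\<epsilon> * M) < \<alpha>" using \<epsilon> by (simp add: algebra_simps)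
  have "\<kappa> \<le> \<epsilon> * (m / (S + 1))"
    unfolding \<kappa>_def using \<epsilon> by (intro mult_left_mono) auto
  then have "(S + 1) * \<kappa> \<le> \<epsilon> * m" using S0 by (simp add: pos_le_divide_eq mult_ac)
  then have S\<kappa>: "S * \<kappa> < \<epsilon> * m" using \<kappa> by (simp add: algebra_simps)
  \<comment> \<open>The comparison starts at time 1, as positivity and differentiability of
    \<open>u\<close> are given for positive times. There the part without the exponential is at
    least 1, and the exponential is below 1.\<close>
  define K where "K x t = 1 + \<epsilon> * M - \<kappa> * (t - 1) + \<epsilon> * \<psi> x - exp (- \<alpha> * u x t)" for x t
  obtain z where z: "z \<in> closure \<Omega>" using assms(3) closure_subset by blast
  \<comment> \<open>At this time the terms without the exponential sum to at most -1, whatever the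
    value of \<open>u\<close>.\<close>
  define b where "b = 1 + (2 + 2 * (\<epsilon> * M)) / \<kappa>"
  have "1 \<le> b" using \<kappa> \<epsilon> M by (simp add: b_def)
  obtain x t where x: "x \<in> closure \<Omega>" and t: "1 < t" and K0: "K x t = 0"
    and K_ge: "\<And>y s. y \<in> closure \<Omega> \<Longrightarrow> 1 \<le> s \<Longrightarrow> s \<le> t \<Longrightarrow> 0 \<le> K y s"
  proof (rule first_zero_time)
    show "compact (closure \<Omega>)" using assms(4) by (simp add: compact_closure)
    show "continuous_on (closure \<Omega> \<times> {1..b}) (\<lambda>(x, t). K x t)"
    proof -
      have c\<psi>: "continuous_on UNIV \<psi>"
        using d\<psi> by (auto intro!: continuous_at_imp_continuous_on intro: has_derivative_continuous)
      have "closure \<Omega> \<times> {1..b} \<subseteq> closure \<Omega> \<times> {0<..}" by auto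
      from continuous_on_subset[OF cu this]
      have "continuous_on (closure \<Omega> \<times> {1..b}) (\<lambda>w. u (fst w) (snd w))"
        by (simp add: case_prod_beta)
      then show ?thesis unfolding K_def case_prod_beta
        by (intro continuous_intros continuous_on_compose2[OF c\<psi>]) auto
    qed
    show "0 < K y 1" if "y \<in> closure \<Omega>" for y
    proof -
      have "\<epsilon> * (- M) \<le> \<epsilon> * \<psi> y" using \<psi>M[OF that] \<epsilon> by (intro mult_left_mono) auto
      moreover have "exp (- \<alpha> * u y 1) < 1" using pos[OF that, of 1] \<alpha> by simp
      ultimately show ?thesis unfolding K_def diff_self mult_zero_right mult_minus_right by linarith
    qed
    show "K z b < 0"
    proof -
      have "\<epsilon> * \<psi> z \<le> \<epsilon> * M" using \<psi>M[OF z] \<epsilon> by (intro mult_left_mono) auto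
      moreover have "\<kappa> * (b - 1) = 2 + 2 * (\<epsilon> * M)" using \<kappa> by (simp add: b_def)
      moreover have "0 < exp (- \<alpha> * u z b)" by simp
      ultimately show ?thesis unfolding K_def diff_self mult_zero_right mult_minus_right by linarith
    qed
  qed (use z \<open>1 \<le> b\<close> in auto)
  have t0: "0 < t" using t by simp
  define E where "E y = exp (- \<alpha> * u y t)" for y
  have E: "0 < E y" for y by (simp add: E_def)
  have dE: "(E has_derivative (\<lambda>h. - \<alpha> * E y * (Du y t \<bullet> h))) (at y within closure \<Omega>)"
    if "y \<in> closure \<Omega>" for y
    unfolding E_def[abs_def] by (rule derivative_eq_intros Du that t0 refl)+ (simp add: mult_ac)
  have min: "K x t \<le> K y t" if "y \<in> closure \<Omega>" for y
    using K_ge[OF that, of t] K0 t by simp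
  define F where "F y = \<epsilon> *\<^sub>R D y + (\<alpha> * E y) *\<^sub>R Du y t" for y
  have dK: "((\<lambda>y. K y t) has_derivative (\<lambda>h. F y \<bullet> h)) (at y within closure \<Omega>)"
    if "y \<in> closure \<Omega>" for y
  proof -
    have "((\<lambda>y. 1 + \<epsilon> * M - \<kappa> * (t - 1) + \<epsilon> * \<psi> y - E y) has_derivative
       (\<lambda>h. \<epsilon> * (D y \<bullet> h) - (- \<alpha> * E y * (Du y t \<bullet> h)))) (at y within closure \<Omega>)"
      by (rule derivative_eq_intros dE that has_derivative_at_withinI[OF d\<psi>] refl)+ simp
    then show ?thesis by (simp add: K_def E_def F_def inner_add)
  qed
  \<comment> \<open>On \<open>{1..t}\<close> the function \<open>K x\<close> is smallest at the
    right endpoint, so its time derivative there is nonpositive.\<close>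
  have time: "\<alpha> * (E x * ut x t) \<le> \<kappa>"
  proof -
    have "((\<lambda>s. K x s) has_real_derivative - \<kappa> + \<alpha> * (E x * ut x t)) (at t)"
      unfolding K_def E_def by (rule derivative_eq_intros ut x t0 refl)+ simp
    from deriv_nonpos_at_left_min[OF this t] show ?thesis
      using K_ge[OF x] K0 by auto
  qed
  show False
  \<comment> \<open>At the first zero, \<open>K \<ge> 0\<close> in space and up to time \<open>t\<close>: the equation excludes an interior point,
    the dynamical condition a boundary point.\<close>
  proof (cases "x \<in> \<Omega>")
    case True
    have dF: "(F has_derivative (\<lambda>h. \<epsilon> *\<^sub>R H x h +
        ((\<alpha> * E x) *\<^sub>R blinfun_apply (D2u x t) h + (\<alpha> * (- \<alpha> * E x * (Du x t \<bullet> h))) *\<^sub>R Du x t))) (at x)"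
      unfolding F_def[abs_def] using dE[OF x] D2u[OF x t0]
      by (intro has_derivative_add has_derivative_scaleR has_derivative_scaleR_right
          has_derivative_mult_right dD) (simp_all add: inner_at[OF True])
    have dK': "((\<lambda>y. K y t) has_derivative (\<lambda>h. F y \<bullet> h)) (at y)" and min': "K x t \<le> K y t"
      if "y \<in> \<Omega>" for y
      using dK[of y] min[of y] that closure_subset[of \<Omega>] by (auto simp: inner_at)
    note F0 = interior_min(1)[OF assms(1) True dK' dF min', simplified]
    note interior_min(2)[OF assms(1) True dK' dF min']
    \<comment> \<open>Differentiating the factor \<open>E\<close> contributes
      \<open>- \<alpha>\<^sup>2 * E x * (Du x t \<bullet> b)\<^sup>2\<close>, which has the
      favourable sign and is dropped.\<close>
    also have "(\<Sum>b\<in>Basis. (\<epsilon> *\<^sub>R H x b +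
        ((\<alpha> * E x) *\<^sub>R blinfun_apply (D2u x t) b + (\<alpha> * (- \<alpha> * E x * (Du x t \<bullet> b))) *\<^sub>R Du x t)) \<bullet> b)
      \<le> (\<Sum>b\<in>Basis. \<epsilon> * (H x b \<bullet> b) + \<alpha> * E x * (blinfun_apply (D2u x t) b \<bullet> b))"
    proof (rule sum_mono)
      fix b :: 'a
      have "0 \<le> \<alpha> * (\<alpha> * E x) * (Du x t \<bullet> b)\<^sup>2" using \<alpha> E[of x] by simp
      then show "(\<epsilon> *\<^sub>R H x b +
        ((\<alpha> * E x) *\<^sub>R blinfun_apply (D2u x t) b + (\<alpha> * (- \<alpha> * E x * (Du x t \<bullet> b))) *\<^sub>R Du x t)) \<bullet> b
        \<le> \<epsilon> * (H x b \<bullet> b) + \<alpha> * E x * (blinfun_apply (D2u x t) b \<bullet> b)"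
        by (simp add: inner_add inner_diff power2_eq_square mult_ac)
    qed
    also have "\<dots> = \<epsilon> * (\<Sum>b\<in>Basis. H x b \<bullet> b) + \<alpha> * E x * trace_blinfun (D2u x t)"
      by (simp add: trace_blinfun_def sum.distrib sum_distrib_left)
    also have "\<epsilon> * (\<Sum>b\<in>Basis. H x b \<bullet> b) \<le> \<epsilon> * M"
      using HM[of x] \<epsilon> by (intro mult_left_mono) auto
    finally have lap: "- (\<epsilon> * M) \<le> \<alpha> * E x * trace_blinfun (D2u x t)" by simp
    let ?e = "exp (max q 0 * u x t)"
    \<comment> \<open>The vanishing gradient of \<open>K\<close> replaces the unknown
      \<open>Du\<close> by the bounded \<open>D\<close>, so the growth of \<open>g\<close> controls
      the convection.\<close>
    have "(\<alpha> * E x) *\<^sub>R Du x t = - (\<epsilon> *\<^sub>R D x)" using F0 by (simp add: F_def add_eq_0_iff)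
    then have "\<alpha> * E x * (g (u x t) \<bullet> Du x t) = g (u x t) \<bullet> (- (\<epsilon> *\<^sub>R D x))"
      by (metis inner_scaleR_right)
    also have "\<dots> \<le> norm (g (u x t)) * norm (- (\<epsilon> *\<^sub>R D x))" by (rule norm_cauchy_schwarz)
    also have "\<dots> \<le> (C * ?e) * (\<epsilon> * M)"
      using C DM[OF x] \<epsilon> pos[OF x t0] by (intro mult_mono) auto
    finally have conv: "\<alpha> * E x * (g (u x t) \<bullet> Du x t) \<le> C * (\<epsilon> * M) * ?e" by (simp add: mult_ac)
    have reac: "E x * exp (p * u x t) = ?e"
      by (simp add: E_def \<alpha>_def flip: exp_add) (simp add: algebra_simps)
    \<comment> \<open>This is the equation multiplied by \<open>\<alpha> * E x\<close>; after
      inserting \<open>time\<close>, \<open>lap\<close> and \<open>conv\<close> only constants and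
      multiples of \<open>?e\<close> remain.\<close>
    have "\<alpha> * (E x * ut x t) = \<alpha> * E x * trace_blinfun (D2u x t)
        - \<alpha> * E x * (g (u x t) \<bullet> Du x t) + \<alpha> * ?e"
      unfolding pde[OF x t0] reac[symmetric] by (simp add: algebra_simps)
    with time lap conv have "(\<alpha> - C * (\<epsilon> * M)) * ?e \<le> \<kappa> + \<epsilon> * M"
      by (simp add: algebra_simps)
    \<comment> \<open>As \<open>u\<close> is positive, \<open>?e\<close> is at least 1; with a
      positive coefficient it may be replaced by 1, which contradicts
      \<open>\<kappa>\<alpha>\<close>.\<close>
    moreover have "0 < \<alpha> - C * (\<epsilon> * M)" using \<kappa>\<alpha> \<kappa> \<epsilon> M by (smt (verit) mult_nonneg_nonneg)
    then have "(\<alpha> - C * (\<epsilon> * M)) * 1 \<le> (\<alpha> - C * (\<epsilon> * M)) * ?e"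
      using pos[OF x t0] by (intro mult_left_mono) auto
    ultimately have "(\<alpha> - C * (\<epsilon> * M)) * 1 \<le> \<kappa> + \<epsilon> * M"
      by (rule order_trans[rotated])
    then show False using \<kappa>\<alpha> by simp
  next
    case False
    then have xF: "x \<in> frontier \<Omega>" using x assms(1) by (simp add: frontier_def interior_open)
    have "F x \<bullet> \<nu> x \<le> 0" using boundary_min[OF assms(6) xF dK[OF x] min] .
    \<comment> \<open>The boundary condition trades the normal derivative of \<open>u\<close> for
      \<open>\<sigma> x t * ut x t\<close>, and \<open>\<sigma> \<ge> 0\<close> lets the bound
      \<open>time\<close> be inserted.\<close>
    moreover have "Du x t \<bullet> \<nu> x = - (\<sigma> x t * ut x t)" using bc[OF xF t0] by simp
    ultimately have "\<epsilon> * (D x \<bullet> \<nu> x) \<le> \<sigma> x t * (\<alpha> * (E x * ut x t))"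
      by (simp add: F_def inner_add mult_ac)
    also have "\<dots> \<le> \<sigma> x t * \<kappa>"
      using time assms(11) xF t0 by (intro mult_left_mono) auto
    also have "\<dots> \<le> S * \<kappa>" using S[OF xF t0] \<kappa> by (intro mult_right_mono) auto
    finally have "\<epsilon> * (D x \<bullet> \<nu> x) < \<epsilon> * m" using S\<kappa> by simp
    then show False using D\<nu>[OF xF] \<epsilon> by simp
  qed
qed

end
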